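(* For any graph $G$ of order $n\geq2$ that is not isomorphic to any of the graphs $G_1,G_2,G_3,\overline{G_1},\overline{G_2},\overline{G_3}$, $$\chi_{2}^{f}(G)+\chi_{2}^{f}(\overline{G})\geq \dfrac{n}{2}+2.$$ Moreover, the bound is sharp, i.e., equality is attained by some such graph.
   Context: All graphs are finite and simple; $\overline{G}$ denotes the complement of $G$. A $2$-frugal coloring of $G$ is a proper vertex coloring in which no color appears more than twice in the (open) neighborhood of any vertex; $\chi_2^f(G)$ is the minimum number of colors in a $2$-frugal coloring of $G$. The graphs $G_1,G_2,G_3$ are the following $4$-regular graphs on $9$ vertices (given by a drawing in the paper). $G_1$ is the circulant graph with vertex set $\mathbb{Z}_9$ in which $i$ and $j$ are adjacent if and only if $i-j\in\{\pm1,\pm3\}$ modulo $9$. $G_2$ is the Cartesian product $K_3\square K_3$, i.e., the graph with vertex set $\{1,2,3\}^2$ in which two distinct vertices are adjacent if and only if they agree in exactly one coordinate. $G_3$ is the graph with vertices $a_1,a_2,a_3,b_1,b_2,b_3,c_1,c_2,c_3$ in which each of $\{a_1,a_2,a_3\}$, $\{b_1,b_2,b_3\}$, $\{c_1,c_2,c_3\}$ induces a triangle, and the remaining edges are $a_1b_1,a_2b_2,a_3b_3$, $b_1c_3,b_2c_1,b_3c_2$, $a_1c_1,a_2c_3,a_3c_2$. *)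

theory Defs
  imports Complex_Main "HOL-Number_Theory.Cong" "Graph_Theory.Graph_Theory"
begin

text \<open>
  A finite simple graph is a \<^locale>\<open>pair_graph\<close>: a finite loopless digraph without parallel arcs
  whose arc relation is symmetric, so an edge \<open>uv\<close> is the pair of arcs \<open>(u, v)\<close>, \<open>(v, u)\<close>.
\<close>

definition graph_complement :: "'a pair_pre_digraph \<Rightarrow> 'a pair_pre_digraph" where
  "graph_complement G = \<lparr> pverts = pverts G,
     parcs = {(u, v). u \<in> pverts G \<and> v \<in> pverts G \<and> u \<noteq> v \<and> (u, v) \<notin> parcs G} \<rparr>"

definition open_neighborhood :: "'a pair_pre_digraph \<Rightarrow> 'a \<Rightarrow> 'a set" where
  "open_neighborhood G v = {u. (v, u) \<in> parcs G}"

definition proper_coloring :: "'a pair_pre_digraph \<Rightarrow> ('a \<Rightarrow> nat) \<Rightarrow> bool" where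
  "proper_coloring G c \<longleftrightarrow> (\<forall>(u, v) \<in> parcs G. c u \<noteq> c v)"

definition frugal_coloring :: "nat \<Rightarrow> 'a pair_pre_digraph \<Rightarrow> ('a \<Rightarrow> nat) \<Rightarrow> bool" where
  "frugal_coloring t G c \<longleftrightarrow> proper_coloring G c \<and>
     (\<forall>v \<in> pverts G. \<forall>i. card {u \<in> open_neighborhood G v. c u = i} \<le> t)"

text \<open>
  Only the colors used on vertices of the graph are counted. On a finite graph with \<open>t \<ge> 1\<close> an
  injective coloring is \<open>t\<close>-frugal, so the minimum is over a nonempty set.
\<close>

definition frugal_chromatic_number :: "nat \<Rightarrow> 'a pair_pre_digraph \<Rightarrow> nat" where
  "frugal_chromatic_number t G =
     (LEAST k. \<exists>c. frugal_coloring t G c \<and> card (c ` pverts G) = k)"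

definition graph_isomorphic :: "'a pair_pre_digraph \<Rightarrow> 'b pair_pre_digraph \<Rightarrow> bool" where
  "graph_isomorphic G H \<longleftrightarrow> digraph_iso (with_proj G) (with_proj H)"

text \<open>The circulant graph on \<open>\<int>\<^sub>9\<close>, with residues represented by \<open>0, \<dots>, 8\<close>.\<close>

definition G1 :: "int pair_pre_digraph" where
  "G1 = \<lparr> pverts = {0..<9},
     parcs = {(i, j). i \<in> {0..<9} \<and> j \<in> {0..<9} \<and>
       (\<exists>d \<in> {1, -1, 3, -3}. [i - j = d] (mod 9))} \<rparr>"

definition G2 :: "(nat \<times> nat) pair_pre_digraph" where
  "G2 = \<lparr> pverts = {1, 2, 3} \<times> {1, 2, 3},
     parcs = {(u, v). u \<in> {1, 2, 3} \<times> {1, 2, 3} \<and> v \<in> {1, 2, 3} \<times> {1, 2, 3} \<and>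
       u \<noteq> v \<and> (fst u = fst v \<longleftrightarrow> snd u \<noteq> snd v)} \<rparr>"

datatype G3_vertex = a1 | a2 | a3 | b1 | b2 | b3 | c1 | c2 | c3

definition G3_cross :: "(G3_vertex \<times> G3_vertex) set" where
  "G3_cross = {(a1, b1), (a2, b2), (a3, b3),
               (b1, c3), (b2, c1), (b3, c2),
               (a1, c1), (a2, c3), (a3, c2)}"

definition G3 :: "G3_vertex pair_pre_digraph" where
  "G3 = \<lparr> pverts = UNIV,
     parcs = {(u, v). u \<noteq> v \<and> (\<exists>T \<in> {{a1, a2, a3}, {b1, b2, b3}, {c1, c2, c3}}. u \<in> T \<and> v \<in> T)}
       \<union> G3_cross \<union> G3_cross\<inverse> \<rparr>"

hide_const (open) a1 a2 a3 b1 b2 b3 c1 c2 c3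

definition exceptional_graph :: "'a pair_pre_digraph \<Rightarrow> bool" where
  "exceptional_graph G \<longleftrightarrow>
     graph_isomorphic G G1 \<or> graph_isomorphic G G2 \<or> graph_isomorphic G G3 \<or>
     graph_isomorphic G (graph_complement G1) \<or> graph_isomorphic G (graph_complement G2) \<or>
     graph_isomorphic G (graph_complement G3)"

end

theory Submission
  imports Defs
begin

text \<open>
  Take optimal colorings \<open>c\<close> of \<open>G\<close> and \<open>d\<close> of the complement, with \<open>a\<close> and \<open>b\<close> colors. A color class
  of \<open>c\<close> is independent and a color class of \<open>d\<close> is a clique, so the two meet in at most one vertex;
  hence \<open>v \<mapsto> (c v, d v)\<close> is injective and \<open>n \<le> a * b\<close> (\<open>card_le_mult\<close>). Frugality gives more. Between
  an independent class of size \<open>s\<close> and a clique class of size \<open>t\<close>, every vertex of the clique has at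
  most two neighbors in the independent class, and every vertex of the independent class has at most
  two non-neighbors in the clique. Every pair is either adjacent or not, so \<open>(s - 2) * (t - 2) \<le> 4\<close>,
  and even \<open>(s - 2) * (t - 2) \<le> 1\<close> if the classes meet (\<open>class_sizes\<close>).

  If all classes of one of the colorings have at most two elements, that coloring uses at least
  \<open>n / 2\<close> colors, and the other one uses two unless a graph has no edges, when the bound is clear.
  Otherwise both colorings have a class of size at least three, so all classes have size at most six.
  Now let each vertex carry the weight \<open>1 / s + 1 / t\<close>, where \<open>s\<close> and \<open>t\<close> are the sizes of its two
  classes. The weights add up to \<open>a + b\<close>, and each is at least \<open>2 / 3\<close>: since its two classes meet,
  either both have size at most three, or one has size at most two and the other at most six. Thus
  \<open>a + b \<ge> 2 * n / 3\<close> (\<open>weight_bound\<close>). Together with \<open>n \<le> a * b\<close> this implies \<open>a + b \<ge> n / 2 + 2\<close>,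
  with the single exception \<open>n = 9\<close>, \<open>a = b = 3\<close> (\<open>bound_or_grid\<close>).

  In the exceptional case the vertices form a full three-by-three grid whose rows are cliques and
  whose columns are independent. Frugality then fixes all remaining edges once a single one is known
  (\<open>grid_adjacency\<close>), and the graph is \<open>K\<^sub>3 \<box> K\<^sub>3\<close> (\<open>rook_coordinates\<close>), which is excluded. Equality
  holds for a single edge: two colors for the edge and one for its complement make \<open>3 = 2 / 2 + 2\<close>.
\<close>

section \<open>A pair of frugal colorings of a graph and its complement\<close>

text \<open>Giving each vertex the reciprocal of the size of its class makes each class weigh one.\<close>

lemma sum_inverse_class_size:
  assumes "finite V"
  shows "(\<Sum>v\<in>V. 1 / real (card {u \<in> V. c u = c v})) = real (card (c ` V))"
proof -
  have "(\<Sum>v\<in>V. 1 / real (card {u \<in> V. c u = c v}))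
      = (\<Sum>i\<in>c ` V. \<Sum>v\<in>{v \<in> V. c v = i}. 1 / real (card {u \<in> V. c u = c v}))"
    by (rule sum.image_gen[OF assms])
  also have "\<dots> = (\<Sum>i\<in>c ` V. 1)"
  proof (rule sum.cong)
    fix i assume "i \<in> c ` V"
    then have "card {v \<in> V. c v = i} \<noteq> 0" using assms by auto
    then show "(\<Sum>v\<in>{v \<in> V. c v = i}. 1 / real (card {u \<in> V. c u = c v})) = 1" by simp
  qed simp
  finally show ?thesis by simp
qed

text \<open>
  The complement appears only through the relation \<open>u \<noteq> v \<and> \<not> A u v\<close>. This makes the assumptions
  invariant under exchanging the graph with its complement, so every result has a dual for free.
\<close>

locale complementary_frugal_colorings =
  fixes V :: "'a set" and A :: "'a \<Rightarrow> 'a \<Rightarrow> bool" and c d :: "'a \<Rightarrow> nat"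
  assumes finite_V: "finite V"
    and sym: "A u v \<longleftrightarrow> A v u"
    and irrefl: "\<not> A v v"
    and proper: "\<lbrakk>u \<in> V; v \<in> V; A u v\<rbrakk> \<Longrightarrow> c u \<noteq> c v"
    and frugal: "v \<in> V \<Longrightarrow> card {u \<in> V. A v u \<and> c u = i} \<le> 2"
    and co_proper: "\<lbrakk>u \<in> V; v \<in> V; u \<noteq> v; \<not> A u v\<rbrakk> \<Longrightarrow> d u \<noteq> d v"
    and co_frugal: "v \<in> V \<Longrightarrow> card {u \<in> V. (v \<noteq> u \<and> \<not> A v u) \<and> d u = i} \<le> 2"
begin

lemma swap: "complementary_frugal_colorings V (\<lambda>u v. u \<noteq> v \<and> \<not> A u v) d c"
proof
  fix v i assume "v \<in> V"
  have "{u \<in> V. (v \<noteq> u \<and> \<not> (v \<noteq> u \<and> \<not> A v u)) \<and> c u = i} \<subseteq> {u \<in> V. A v u \<and> c u = i}"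
    by auto
  then have "card {u \<in> V. (v \<noteq> u \<and> \<not> (v \<noteq> u \<and> \<not> A v u)) \<and> c u = i}
      \<le> card {u \<in> V. A v u \<and> c u = i}"
    by (intro card_mono) (use finite_V in auto)
  also have "\<dots> \<le> 2" using frugal[OF \<open>v \<in> V\<close>] .
  finally show "card {u \<in> V. (v \<noteq> u \<and> \<not> (v \<noteq> u \<and> \<not> A v u)) \<and> c u = i} \<le> 2" .
next
  fix u v show "(u \<noteq> v \<and> \<not> A u v) = (v \<noteq> u \<and> \<not> A v u)" using sym[of u v] by auto
qed (use finite_V proper co_proper co_frugal in auto)

text \<open>Two vertices with the same pair of colors could be neither adjacent nor non-adjacent.\<close>

lemma inj_on_both: "inj_on (\<lambda>v. (c v, d v)) V"
  using proper co_proper by (intro inj_onI) blast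

lemma card_le_mult: "card V \<le> card (c ` V) * card (d ` V)"
proof -
  have "card V = card ((\<lambda>v. (c v, d v)) ` V)" by (simp add: card_image inj_on_both)
  also have "\<dots> \<le> card (c ` V \<times> d ` V)"
    by (intro card_mono) (use finite_V in auto)
  finally show ?thesis by (simp add: card_cartesian_product)
qed

text \<open>
  Double counting of \<open>I \<times> C\<close>. Adjacent pairs are counted at their vertex in the clique \<open>C\<close>, and
  non-adjacent ones at their vertex in the independent set \<open>I\<close>; either way at most two per vertex. A
  common vertex of \<open>I\<close> and \<open>C\<close> lies in no adjacent pair as an element of \<open>C\<close>, because it belongs to
  the independent \<open>I\<close>, and in no non-adjacent pair as an element of \<open>I\<close>. This removes it from both
  counts and gives the gain \<open>3 * card (I \<inter> C)\<close>.
\<close>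

lemma class_sizes:
  fixes i j
  defines "I \<equiv> {v \<in> V. c v = i}" and "C \<equiv> {v \<in> V. d v = j}"
  shows "card I * card C + 3 * card (I \<inter> C) \<le> 2 * (card I + card C)"
proof -
  define K where "K = I \<inter> C"
  have fin: "finite I" "finite C" "finite K" unfolding K_def I_def C_def using finite_V by auto
  have cI: "card (I - K) = card I - card K" and cC: "card (C - K) = card C - card K"
    and le: "card K \<le> card I" "card K \<le> card C"
    using fin by (auto simp: K_def card_Diff_subset card_mono)
  have adj: "card (SIGMA v:C - K. {u \<in> I. A v u}) \<le> 2 * (card C - card K)"
  proof -
    have "card (SIGMA v:C - K. {u \<in> I. A v u}) = (\<Sum>v\<in>C - K. card {u \<in> I. A v u})"
      using fin by (intro card_SigmaI) auto
    also have "\<dots> \<le> (\<Sum>v\<in>C - K. 2)"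
    proof (rule sum_mono)
      fix v assume "v \<in> C - K"
      then have "v \<in> V" by (auto simp: C_def)
      have "{u \<in> I. A v u} = {u \<in> V. A v u \<and> c u = i}" by (auto simp: I_def)
      then show "card {u \<in> I. A v u} \<le> 2" using frugal[OF \<open>v \<in> V\<close>] by simp
    qed
    finally show ?thesis using cC by simp
  qed
  have nadj: "card (SIGMA v:I - K. {u \<in> C. v \<noteq> u \<and> \<not> A v u}) \<le> 2 * (card I - card K)"
  proof -
    have "card (SIGMA v:I - K. {u \<in> C. v \<noteq> u \<and> \<not> A v u})
        = (\<Sum>v\<in>I - K. card {u \<in> C. v \<noteq> u \<and> \<not> A v u})"
      using fin by (intro card_SigmaI) auto
    also have "\<dots> \<le> (\<Sum>v\<in>I - K. 2)"
    proof (rule sum_mono)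
      fix v assume "v \<in> I - K"
      then have "v \<in> V" by (auto simp: I_def)
      have "{u \<in> C. v \<noteq> u \<and> \<not> A v u} = {u \<in> V. (v \<noteq> u \<and> \<not> A v u) \<and> d u = j}"
        by (auto simp: C_def)
      then show "card {u \<in> C. v \<noteq> u \<and> \<not> A v u} \<le> 2" using co_frugal[OF \<open>v \<in> V\<close>] by simp
    qed
    finally show ?thesis using cI by simp
  qed
  have "I \<times> C \<subseteq> prod.swap ` (SIGMA v:C - K. {u \<in> I. A v u})
      \<union> (SIGMA v:I - K. {u \<in> C. v \<noteq> u \<and> \<not> A v u}) \<union> (\<lambda>v. (v, v)) ` K" (is "_ \<subseteq> ?X \<union> ?Y \<union> ?Z")
  proof (rule subrelI)
    fix u v assume uv: "(u, v) \<in> I \<times> C"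
    then have V: "u \<in> V" "v \<in> V" "c u = i" "d v = j" by (auto simp: I_def C_def)
    show "(u, v) \<in> ?X \<union> ?Y \<union> ?Z"
    proof (cases "A v u")
      case True
      then have "c v \<noteq> i" using proper[of v u] V by auto
      then show ?thesis using uv True by (auto simp: K_def I_def prod.swap_def image_iff)
    next
      case False
      show ?thesis
      proof (cases "u = v")
        case True
        then show ?thesis using uv by (auto simp: K_def)
      next
        case neq: False
        then have "d u \<noteq> j" using co_proper[of u v] V False sym by auto
        then show ?thesis using uv False neq sym[of u v] by (auto simp: K_def C_def)
      qed
    qed
  qed
  then have "card (I \<times> C) \<le> card (?X \<union> ?Y \<union> ?Z)"
    using fin by (intro card_mono) auto
  also have "\<dots> \<le> card ?X + card ?Y + card ?Z"
    by (meson card_Un_le le_trans add_le_mono1)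
  also have "card ?X = card (SIGMA v:C - K. {u \<in> I. A v u})"
    by (intro card_image) auto
  also have "card ?Z = card K" by (intro card_image) (auto intro: inj_onI)
  finally have "card I * card C \<le> 2 * (card C - card K) + 2 * (card I - card K) + card K"
    using adj nadj by (simp add: card_cartesian_product)
  moreover have "p + 3 * k \<le> 2 * (s + t)"
    if "p \<le> 2 * (t - k) + 2 * (s - k) + k" "k \<le> s" "k \<le> t" for p s t k :: nat
    using that by presburger
  ultimately show ?thesis using le unfolding K_def by blast
qed

text \<open>One color is enough only for a graph without edges, whose complement is complete.\<close>

lemma card_co_colors_if_monochromatic:
  assumes "card (c ` V) = 1"
  shows "card (d ` V) = card V"
proof -
  obtain k where k: "c ` V = {k}" using assms card_1_singletonE by blast
  have "inj_on d V"
  proof (rule inj_onI)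
    fix u v assume uv: "u \<in> V" "v \<in> V" "d u = d v"
    then have "c u = k" "c v = k" using k by auto
    then show "u = v" using proper co_proper uv by metis
  qed
  then show ?thesis by (rule card_image)
qed

lemma small_co_classes:
  assumes "\<And>j. card {v \<in> V. d v = j} \<le> 2"
  shows "card V \<le> 2 * card (d ` V)"
proof -
  have "card V = (\<Sum>j\<in>d ` V. card {v \<in> V. d v = j})"
    using sum.image_gen[OF finite_V, of "\<lambda>_. 1::nat" d] by simp
  also have "\<dots> \<le> (\<Sum>j\<in>d ` V. 2)" by (intro sum_mono assms)
  finally show ?thesis by simp
qed

text \<open>
  The classes of size at least three serve only to bound all classes of the other coloring by six;
  the two classes of a single vertex then leave few possible sizes.
\<close>

lemma weight_bound:
  assumes i: "card {v \<in> V. c v = i} \<ge> 3" and j: "card {v \<in> V. d v = j} \<ge> 3"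
  shows "2 * card V \<le> 3 * (card (c ` V) + card (d ` V))"
proof -
  have "(\<Sum>v\<in>V. 2 / 3) \<le> (\<Sum>v\<in>V. 1 / real (card {u \<in> V. c u = c v}) + 1 / real (card {u \<in> V. d u = d v}))"
  proof (rule sum_mono)
    fix v assume v: "v \<in> V"
    define s t where "s = card {u \<in> V. c u = c v}" and "t = card {u \<in> V. d u = d v}"
    have s0: "s \<ge> 1" and t0: "t \<ge> 1"
      using v finite_V by (auto simp: s_def t_def Suc_le_eq card_gt_0_iff)
    have "{u \<in> V. c u = c v} \<inter> {u \<in> V. d u = d v} \<noteq> {}" using v by auto
    then have "card ({u \<in> V. c u = c v} \<inter> {u \<in> V. d u = d v}) \<ge> 1"
      using finite_V by (simp add: Suc_le_eq card_gt_0_iff)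
    then have st: "s * t + 3 \<le> 2 * (s + t)"
      using class_sizes[of "c v" "d v"] unfolding s_def t_def by linarith
    have le6: "x \<le> 6" if xy: "x * y \<le> 2 * (x + y)" and y: "y \<ge> 3" for x y :: nat
    proof (rule ccontr)
      assume "\<not> x \<le> 6"
      then obtain p where p: "x = 7 + p" using le_Suc_ex[of 7 x] by auto
      obtain q where q: "y = 3 + q" using y le_Suc_ex by blast
      show False using xy unfolding p q by (simp add: algebra_simps)
    qed
    \<comment> \<open>The pair of classes need not meet here, so only the weaker bound \<open>(s - 2) * (t - 2) \<le> 4\<close> is used.\<close>
    have s6: "s \<le> 6"
      using le6[OF _ j, of s] class_sizes[of "c v" j] unfolding s_def by linarith
    have t6: "t \<le> 6"
      using le6[OF _ i, of t] class_sizes[of i "d v"] unfolding t_def by (simp add: algebra_simps)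
    have "s \<in> {1,2,3,4,5,6}" "t \<in> {1,2,3,4,5,6}" using s0 t0 s6 t6 by auto
    then have "2 / 3 \<le> 1 / real s + 1 / real t" using st by auto
    then show "2 / 3 \<le> 1 / real (card {u \<in> V. c u = c v}) + 1 / real (card {u \<in> V. d u = d v})"
      unfolding s_def t_def .
  qed
  then have "2 / 3 * real (card V) \<le> real (card (c ` V)) + real (card (d ` V))"
    by (simp add: sum.distrib sum_inverse_class_size finite_V)
  then show ?thesis by simp
qed

text \<open>
  A failure of the bound means \<open>2 * (a + b) \<le> n + 3\<close>. Then \<open>weight_bound\<close> forces \<open>a + b \<le> 6\<close>, and among
  the few remaining pairs only \<open>a = b = 3\<close> allows \<open>2 * (a + b) - 3 \<le> n \<le> a * b\<close>.
\<close>

lemma bound_or_grid: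
  assumes n: "card V \<ge> 2"
  shows "2 * (card (c ` V) + card (d ` V)) \<ge> card V + 4
    \<or> card V = 9 \<and> card (c ` V) = 3 \<and> card (d ` V) = 3"
proof -
  interpret S: complementary_frugal_colorings V "\<lambda>u v. u \<noteq> v \<and> \<not> A u v" d c by (rule swap)
  let ?a = "card (c ` V)" and ?b = "card (d ` V)"
  have "V \<noteq> {}" using n by auto
  then have pos: "?a \<ge> 1" "?b \<ge> 1" using finite_V by (auto simp: Suc_le_eq card_gt_0_iff)
  show ?thesis
  proof (cases "?a = 1 \<or> ?b = 1")
    case True
    then show ?thesis using card_co_colors_if_monochromatic S.card_co_colors_if_monochromatic n by auto
  next
    case False
    then have ab: "?a \<ge> 2" "?b \<ge> 2" using pos by auto
    show ?thesis
    proof (cases "(\<forall>j. card {v \<in> V. d v = j} \<le> 2) \<or> (\<forall>i. card {v \<in> V. c v = i} \<le> 2)")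
      case True
      then show ?thesis using small_co_classes S.small_co_classes ab by fastforce
    next
      case False
      then obtain i j where "\<not> card {v \<in> V. c v = i} \<le> 2" "\<not> card {v \<in> V. d v = j} \<le> 2"
        by blast
      then have "card {v \<in> V. c v = i} \<ge> 3" "card {v \<in> V. d v = j} \<ge> 3" by auto
      then have w: "2 * card V \<le> 3 * (?a + ?b)" by (rule weight_bound)
      show ?thesis
      proof (rule ccontr)
        assume no: "\<not> ?thesis"
        then have "2 * (?a + ?b) \<le> card V + 3" by linarith
        with w have "?a + ?b \<le> 6" by presburger
        with ab have "?a \<in> {2,3,4}" "?b \<in> {2,3,4}" by auto
        then show False using no card_le_mult \<open>?a + ?b \<le> 6\<close> by auto
      qed
    qed
  qed
qed

section \<open>The three-by-three grid\<close>

text \<open>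
  The column of \<open>w\<close> and \<open>w'\<close> also contains a vertex \<open>z\<close> of the row of \<open>u\<close>. Rows are cliques, so \<open>z\<close> is
  a neighbor of \<open>u\<close>, and frugality leaves room for one more neighbor only.
\<close>

lemma not_two_in_column:
  assumes grid: "(\<lambda>v. (c v, d v)) ` V = c ` V \<times> d ` V"
    and V: "u \<in> V" "w \<in> V" "w' \<in> V"
    and "w \<noteq> w'" "c w = c w'" "c w \<noteq> c u" "d w \<noteq> d u" "d w' \<noteq> d u"
  shows "\<not> (A u w \<and> A u w')"
proof
  assume A: "A u w \<and> A u w'"
  have "(c w, d u) \<in> (\<lambda>v. (c v, d v)) ` V" unfolding grid using V by auto
  then obtain z where z: "z \<in> V" "c z = c w" "d z = d u" by auto
  then have "z \<noteq> u" using assms by metis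
  then have "A u z" using co_proper[of u z] z V by auto
  have "card {z, w, w'} \<le> card {x \<in> V. A u x \<and> c x = c w}"
    using A \<open>A u z\<close> z assms finite_V by (intro card_mono) auto
  moreover have "z \<noteq> w" "z \<noteq> w'" using z assms by metis+
  then have "card {z, w, w'} = 3" using \<open>w \<noteq> w'\<close> by simp
  ultimately show False using frugal[OF \<open>u \<in> V\<close>, of "c w"] by linarith
qed

end

text \<open>
  Here \<open>P i j k l\<close> says that the vertex in row \<open>i\<close> and column \<open>j\<close> is adjacent to the one in row \<open>k\<close> and
  column \<open>l\<close>. Consider the four vertices off the row and the column of \<open>(i, j)\<close>. By \<open>col\<close> and \<open>row\<close>,
  each column of this two-by-two square has at most one neighbor of \<open>(i, j)\<close> and each row at least
  one, so the neighbors are exactly one of the two diagonals (\<open>one\<close>). Applying this at both ends of an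
  edge shifts the edge cyclically along the columns (\<open>turn\<close>), so the edge \<open>start\<close> determines all
  others: adjacency means that the column advances by as much as the row, modulo three.
\<close>

lemma grid_adjacency:
  fixes P :: "nat \<Rightarrow> nat \<Rightarrow> nat \<Rightarrow> nat \<Rightarrow> bool"
  assumes sym: "\<And>i j k l. P i j k l \<longleftrightarrow> P k l i j"
    and col: "\<And>i j k k' l. \<lbrakk>i < 3; j < 3; k < 3; k' < 3; l < 3; k \<noteq> i; k' \<noteq> i; k \<noteq> k'; l \<noteq> j\<rbrakk>
      \<Longrightarrow> \<not> (P i j k l \<and> P i j k' l)"
    and row: "\<And>i j k l l'. \<lbrakk>i < 3; j < 3; k < 3; l < 3; l' < 3; k \<noteq> i; l \<noteq> j; l' \<noteq> j; l \<noteq> l'\<rbrakk>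
      \<Longrightarrow> P i j k l \<or> P i j k l'"
    and start: "P 0 0 1 1"
    and ijkl: "i < 3" "j < 3" "k < 3" "l < 3" "k \<noteq> i" "l \<noteq> j"
  shows "P i j k l \<longleftrightarrow> (j + k) mod 3 = (l + i) mod 3"
proof -
  have one: "P i j k' l' \<longleftrightarrow> P i j k l" "P i j k l' \<longleftrightarrow> \<not> P i j k l" "P i j k' l \<longleftrightarrow> \<not> P i j k l"
    if "i < 3" "j < 3" "k < 3" "k' < 3" "l < 3" "l' < 3"
      "k \<noteq> i" "k' \<noteq> i" "k \<noteq> k'" "l \<noteq> j" "l' \<noteq> j" "l \<noteq> l'" for i j k k' l l'
    using that col[of i j k k' l] col[of i j k k' l'] row[of i j k l l'] row[of i j k' l l'] by blast+
  have third: "\<exists>k' < 3. k' \<noteq> i \<and> k' \<noteq> k" for i k :: nat by presburger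
  have turn: "P i j' k l'" if "P i j k l" "i < 3" "j < 3" "k < 3" "l < 3" "j' = l" "i \<noteq> k" "j \<noteq> l"
     "l' < 3" "l' \<noteq> j" "l' \<noteq> l" for i j k l j' l'
  proof -
    obtain k' where k': "k' < 3" "k' \<noteq> i" "k' \<noteq> k" using third by metis
    have "\<not> P i j k l'" using one(2)[of i j k k' l l'] that k' by auto
    then have "\<not> P k l' i j" using sym by blast
    then have "P k l' i l" using one(2)[of k l' i k' j l] that k' by auto
    then show ?thesis using sym that by blast
  qed
  have dg: "P 0 0 2 2" using one(1)[of 0 0 2 1 2 1] start by auto
  have dg': "P 1 1 2 2" using one(1)[of 1 1 2 0 2 0] start sym[of 0 0 1 1] by auto
  have t01: "P 0 1 1 2" "P 0 2 1 0"
    using turn[OF start, of 1 2] turn[of 0 1 1 2 2 0] start by auto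
  have t02: "P 0 2 2 1" "P 0 1 2 0"
    using turn[OF dg, of 2 1] turn[of 0 2 2 1 1 0] by auto
  have t12: "P 1 2 2 0" "P 1 0 2 1"
    using turn[OF dg', of 2 0] turn[of 1 2 2 0 0 1] by auto
  have yes: "P i j k l" if "(j + k) mod 3 = (l + i) mod 3" "i < 3" "j < 3" "k < 3" "l < 3" "k \<noteq> i" "l \<noteq> j"
    for i j k l
  proof -
    have "i \<in> {0,1,2}" "j \<in> {0,1,2}" "k \<in> {0,1,2}" "l \<in> {0,1,2}" using that by auto
    then show ?thesis
      using that(1,6,7) start dg dg' t01 t02 t12
      using sym by auto
  qed
  show ?thesis
  proof (cases "(j + k) mod 3 = (l + i) mod 3")
    case True
    then show ?thesis using yes ijkl by auto
  next
    case False
    \<comment> \<open>The other cell of row \<open>k\<close> in the square satisfies the congruence, so it is the neighbor in that row.\<close>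
    have "\<exists>l' < 3. l' \<noteq> j \<and> l' \<noteq> l \<and> (j + k) mod 3 = (l' + i) mod 3"
    proof -
      have "i \<in> {0,1,2}" "j \<in> {0,1,2}" "k \<in> {0,1,2}" "l \<in> {0,1,2}" using ijkl by auto
      then show ?thesis using False ijkl(5,6)
        by (elim insertE emptyE; simp; presburger)
    qed
    then obtain l' where l': "l' < 3" "l' \<noteq> j" "l' \<noteq> l" "(j + k) mod 3 = (l' + i) mod 3" by blast
    obtain k' where k': "k' < 3" "k' \<noteq> i" "k' \<noteq> k" using third by metis
    have "P i j k l'" using yes[OF l'(4)] ijkl l' by auto
    then show ?thesis using one(2)[of i j k k' l l'] ijkl l' k' False by auto
  qed
qed


lemma card_3_third:
  assumes "card S = 3" "x \<in> S" "y \<in> S" "x \<noteq> y"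
  obtains z where "S = {x, y, z}" "z \<noteq> x" "z \<noteq> y"
proof -
  have "card (S - {x, y}) = 1" using assms by (simp add: card_Diff_subset)
  then obtain z where "S - {x, y} = {z}" using card_1_singletonE by blast
  then show ?thesis using that[of z] assms by blast
qed

lemma card_3_others:
  assumes "card S = 3" "x \<in> S"
  obtains y z where "S = {x, y, z}" "y \<noteq> x" "z \<noteq> x" "y \<noteq> z"
proof -
  have "S \<noteq> {x}" using assms by auto
  then obtain y where "y \<in> S" "y \<noteq> x" using assms by blast
  then show ?thesis using that card_3_third[of S x y] assms by metis
qed

context complementary_frugal_colorings
begin

text \<open>
  Number the rows and columns so that the cells \<open>(0, 0)\<close> and \<open>(1, 1)\<close> are adjacent. Then vertices in
  different rows are adjacent precisely if they agree in \<open>column - row\<close> modulo three, while vertices in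
  a common row are always adjacent. Hence row and \<open>column - row\<close> are the coordinates of \<open>K\<^sub>3 \<box> K\<^sub>3\<close>.
\<close>

lemma rook_coordinates:
  assumes card: "card V = 9" "card (c ` V) = 3" "card (d ` V) = 3"
  obtains f :: "'a \<Rightarrow> nat \<times> nat" where "bij_betw f V ({1, 2, 3} \<times> {1, 2, 3})"
    and "\<And>u v. \<lbrakk>u \<in> V; v \<in> V\<rbrakk>
      \<Longrightarrow> A u v \<longleftrightarrow> u \<noteq> v \<and> (fst (f u) = fst (f v) \<longleftrightarrow> snd (f u) \<noteq> snd (f v))"
proof -
  interpret S: complementary_frugal_colorings V "\<lambda>u v. u \<noteq> v \<and> \<not> A u v" d c by (rule swap)
  have grid: "(\<lambda>v. (c v, d v)) ` V = c ` V \<times> d ` V"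
  proof (rule card_subset_eq)
    show "card ((\<lambda>v. (c v, d v)) ` V) = card (c ` V \<times> d ` V)"
      by (simp add: card_image inj_on_both card_cartesian_product card)
  qed (use finite_V in auto)
  have grid': "(\<lambda>v. (d v, c v)) ` V = d ` V \<times> c ` V"
  proof -
    have "(\<lambda>v. (d v, c v)) ` V = prod.swap ` (\<lambda>v. (c v, d v)) ` V" by (simp add: image_image)
    then show ?thesis unfolding grid by (simp add: product_swap)
  qed
  have cell: "\<exists>v\<in>V. c v = i \<and> d v = j" if "i \<in> c ` V" "j \<in> d ` V" for i j
  proof -
    have "(i, j) \<in> (\<lambda>v. (c v, d v)) ` V" unfolding grid using that by auto
    then show ?thesis by auto
  qed
  have col: "\<not> (A u w \<and> A u w')"
    if "u \<in> V" "w \<in> V" "w' \<in> V" "c w = c w'" "c w \<noteq> c u"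
      "d w \<noteq> d u" "d w' \<noteq> d u" "d w \<noteq> d w'" for u w w'
    using not_two_in_column[OF grid, of u w w'] that by metis
  \<comment> \<open>In the complement the roles of rows and columns are exchanged.\<close>
  have row: "A u w \<or> A u w'"
    if "u \<in> V" "w \<in> V" "w' \<in> V" "d w = d w'" "d w \<noteq> d u"
      "c w \<noteq> c u" "c w' \<noteq> c u" "c w \<noteq> c w'" for u w w'
    using S.not_two_in_column[OF grid', of u w w'] that by metis

  obtain v0 where v0: "v0 \<in> V" using card(1) by fastforce
  obtain v1 where v1: "v1 \<in> V" "A v0 v1" "c v1 \<noteq> c v0" "d v1 \<noteq> d v0"
  proof -
    obtain r r' where r: "d ` V = {d v0, r, r'}" "r \<noteq> d v0"
      using card_3_others[OF card(3), of "d v0"] v0 by blast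
    obtain k k' where k: "c ` V = {c v0, k, k'}" "k \<noteq> c v0" "k' \<noteq> c v0" "k \<noteq> k'"
      using card_3_others[OF card(2), of "c v0"] v0 by blast
    obtain w w' where "w \<in> V" "c w = k" "d w = r" "w' \<in> V" "c w' = k'" "d w' = r"
      using cell[of k r] cell[of k' r] r k by auto
    then show ?thesis using row[of v0 w w'] r k v0 that by metis
  qed
  obtain k where k: "c ` V = {c v0, c v1, k}" "k \<noteq> c v0" "k \<noteq> c v1"
    using card_3_third[OF card(2) imageI[OF v0] imageI[OF v1(1)] v1(3)[symmetric]] by blast
  obtain r where r: "d ` V = {d v0, d v1, r}" "r \<noteq> d v0" "r \<noteq> d v1"
    using card_3_third[OF card(3) imageI[OF v0] imageI[OF v1(1)] v1(4)[symmetric]] by blast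
  define R :: "'a \<Rightarrow> nat" where "R v = (if d v = d v0 then 0 else if d v = d v1 then 1 else 2)" for v
  define K :: "'a \<Rightarrow> nat" where "K v = (if c v = c v0 then 0 else if c v = c v1 then 1 else 2)" for v
  have R3: "R v < 3" and K3: "K v < 3" for v by (auto simp: R_def K_def)
  have RV: "d v \<in> {d v0, d v1, r}" and KV: "c v \<in> {c v0, c v1, k}" if "v \<in> V" for v
    using that r k by auto
  have R_iff: "R u = R v \<longleftrightarrow> d u = d v" if "u \<in> V" "v \<in> V" for u v
    using RV[OF that(1)] RV[OF that(2)] by (auto simp: R_def)
  have K_iff: "K u = K v \<longleftrightarrow> c u = c v" if "u \<in> V" "v \<in> V" for u v
    using KV[OF that(1)] KV[OF that(2)] by (auto simp: K_def)
  have RK_inj: "u = v" if "u \<in> V" "v \<in> V" "R u = R v" "K u = K v" for u v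
    using that R_iff K_iff inj_onD[OF inj_on_both, of u v] by auto
  have ex: "\<exists>v. v \<in> V \<and> R v = i \<and> K v = j" if "i < 3" "j < 3" for i j
  proof -
    have "\<exists>y \<in> d ` V. \<forall>v. d v = y \<longrightarrow> R v = i"
    proof -
      have "i = 0 \<or> i = 1 \<or> i = 2" using that by auto
      then show ?thesis using r v1(4) by (elim disjE) (auto simp: R_def)
    qed
    moreover have "\<exists>y \<in> c ` V. \<forall>v. c v = y \<longrightarrow> K v = j"
    proof -
      have "j = 0 \<or> j = 1 \<or> j = 2" using that by auto
      then show ?thesis using k v1(3) by (elim disjE) (auto simp: K_def)
    qed
    ultimately show ?thesis using cell by metis
  qed
  define x where "x i j = (SOME v. v \<in> V \<and> R v = i \<and> K v = j)" for i j
  have x: "x i j \<in> V" "R (x i j) = i" "K (x i j) = j" if "i < 3" "j < 3" for i j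
    using someI_ex[OF ex[OF that]] unfolding x_def by auto
  have x_RK: "x (R v) (K v) = v" if "v \<in> V" for v
    using RK_inj x R3 K3 that by metis
  have x_d: "d (x i j) = d (x i' j') \<longleftrightarrow> i = i'" and x_c: "c (x i j) = c (x i' j') \<longleftrightarrow> j = j'"
    if "i < 3" "j < 3" "i' < 3" "j' < 3" for i j i' j'
    using R_iff[of "x i j" "x i' j'"] K_iff[of "x i j" "x i' j'"] x that by auto
  have start: "A (x 0 0) (x 1 1)"
  proof -
    have "R v0 = 0" "K v0 = 0" "R v1 = 1" "K v1 = 1" using v1 by (auto simp: R_def K_def)
    then show ?thesis using x_RK v0 v1 by metis
  qed
  have adj: "A (x i j) (x k l) \<longleftrightarrow> (j + k) mod 3 = (l + i) mod 3"
    if "i < 3" "j < 3" "k < 3" "l < 3" "k \<noteq> i" "l \<noteq> j" for i j k l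
  proof (rule grid_adjacency[where P = "\<lambda>i j k l. A (x i j) (x k l)"])
    show "A (x i j) (x k l) = A (x k l) (x i j)" for i j k l by (rule sym)
    show "\<not> (A (x i j) (x k l) \<and> A (x i j) (x k' l))"
      if "i < 3" "j < 3" "k < 3" "k' < 3" "l < 3" "k \<noteq> i" "k' \<noteq> i" "k \<noteq> k'" "l \<noteq> j" for i j k k' l
      by (rule col) (use that x x_c x_d in simp_all)
    show "A (x i j) (x k l) \<or> A (x i j) (x k l')"
      if "i < 3" "j < 3" "k < 3" "l < 3" "l' < 3" "k \<noteq> i" "l \<noteq> j" "l' \<noteq> j" "l \<noteq> l'" for i j k l l'
      by (rule row) (use that x x_c x_d in simp_all)
  qed (use start that in auto)
  \<comment> \<open>The summand 3 keeps the subtraction on naturals from truncating; coordinates start at 1.\<close>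
  define f where "f v = (R v + 1, (K v + 3 - R v) mod 3 + 1)" for v
  have shear: "(m + 3 - i) mod 3 = (l + 3 - j) mod 3 \<longleftrightarrow> (m + j) mod 3 = (l + i) mod 3"
    if "i < 3" "j < 3" for i j l m :: nat
  proof -
    have "m + 3 - i + (i + j) = m + j + 3" "l + 3 - j + (i + j) = l + i + 3"
      using that by simp_all
    then have "[m + 3 - i = l + 3 - j] (mod 3) \<longleftrightarrow> [m + j + 3 = l + i + 3] (mod 3)"
      using cong_add_rcancel_nat[of "m + 3 - i" "i + j" "l + 3 - j" 3] by (simp only:)
    then show ?thesis by (simp only: cong_def mod_add_self2)
  qed
  have same: "m = l" if "(m + i) mod 3 = (l + i) mod 3" "m < 3" "l < 3" for i l m :: nat
  proof -
    have "[m + i = l + i] (mod 3)" using that(1) by (simp only: cong_def)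
    then have "[m = l] (mod 3)" by (simp only: cong_add_rcancel_nat)
    then show ?thesis using that(2,3) by (simp add: cong_def)
  qed
  show ?thesis
  proof
    have inj: "inj_on f V"
    proof (rule inj_onI)
      fix u v assume uv: "u \<in> V" "v \<in> V" "f u = f v"
      then have "R u = R v" "(K u + R v) mod 3 = (K v + R u) mod 3"
        using shear[OF R3 R3] by (auto simp: f_def)
      then show "u = v" using RK_inj uv same K3 by metis
    qed
    moreover have "f ` V = {1, 2, 3} \<times> {1, 2, 3}"
    proof (rule card_subset_eq)
      show "f ` V \<subseteq> {1, 2, 3} \<times> {1, 2, 3}"
      proof (rule image_subsetI)
        fix v
        have "R v \<in> {0, 1, 2}" "(K v + 3 - R v) mod 3 < 3" using R3[of v] by auto
        then have "R v + 1 \<in> {1, 2, 3}" "(K v + 3 - R v) mod 3 + 1 \<in> {1, 2, 3}" by auto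
        then show "f v \<in> {1, 2, 3} \<times> {1, 2, 3}" unfolding f_def by blast
      qed
      show "card (f ` V) = card ({1, 2, 3} \<times> {1, 2, 3} :: (nat \<times> nat) set)"
        using card_image[OF inj] card(1) by (simp add: card_cartesian_product)
    qed simp
    ultimately show "bij_betw f V ({1, 2, 3} \<times> {1, 2, 3})" by (simp add: bij_betw_def)
  next
    fix u v assume uv: "u \<in> V" "v \<in> V"
    have snd_f: "snd (f u) = snd (f v) \<longleftrightarrow> (K u + R v) mod 3 = (K v + R u) mod 3"
      using shear[OF R3 R3] by (simp add: f_def)
    have fst_f: "fst (f u) = fst (f v) \<longleftrightarrow> R u = R v" by (simp add: f_def)
    consider "R u = R v" | "R u \<noteq> R v" "K u = K v" | "R u \<noteq> R v" "K u \<noteq> K v" by blast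
    then show "A u v \<longleftrightarrow> u \<noteq> v \<and> (fst (f u) = fst (f v) \<longleftrightarrow> snd (f u) \<noteq> snd (f v))"
    proof cases
      case 1
      then have "A u v \<longleftrightarrow> u \<noteq> v" using uv R_iff co_proper irrefl by blast
      then show ?thesis using 1 snd_f fst_f same[of "K u" "R v" "K v"] K3 RK_inj uv by auto
    next
      case 2
      then have "\<not> A u v" using uv K_iff proper by blast
      moreover have "(K u + R v) mod 3 \<noteq> (K v + R u) mod 3"
        using same[of "R u" "K u" "R v"] 2 R3 by (auto simp: add.commute)
      ultimately show ?thesis using 2 snd_f fst_f by auto
    next
      case 3
      then have "A u v \<longleftrightarrow> (K u + R v) mod 3 = (K v + R u) mod 3"
        using adj[of "R u" "K u" "R v" "K v"] R3 K3 x_RK uv by auto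
      then show ?thesis using 3 snd_f fst_f by auto
    qed
  qed
qed

end

section \<open>Isomorphism and frugal chromatic numbers\<close>

lemma graph_isomorphicI:
  assumes "pair_wf_digraph G" and bij: "bij_betw f (pverts G) (pverts H)"
    and H: "parcs H \<subseteq> pverts H \<times> pverts H"
    and arcs: "\<And>u v. \<lbrakk>u \<in> pverts G; v \<in> pverts G\<rbrakk> \<Longrightarrow> (u, v) \<in> parcs G \<longleftrightarrow> (f u, f v) \<in> parcs H"
  shows "graph_isomorphic G H"
proof -
  interpret pair_wf_digraph G by fact
  define hom where "hom = \<lparr>iso_verts = f, iso_arcs = map_prod f f, iso_head = snd, iso_tail = fst\<rparr>"
  have inj: "inj_on f (pverts G)" and im: "f ` pverts G = pverts H"
    using bij by (auto simp: bij_betw_def)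
  have G: "parcs G \<subseteq> pverts G \<times> pverts G" using in_arcsD1 in_arcsD2 by auto
  have "inj_on (map_prod f f) (parcs G)"
    using map_prod_inj_on[OF inj inj] G by (rule inj_on_subset)
  then have "pre_digraph.digraph_isomorphism (with_proj G) hom"
    using inj wf_digraph_axioms by (auto simp: pre_digraph.digraph_isomorphism_def hom_def)
  moreover have "map_prod f f ` parcs G = parcs H"
  proof (intro equalityI subrelI)
    fix x y assume "(x, y) \<in> map_prod f f ` parcs G"
    then obtain u v where "(u, v) \<in> parcs G" "x = f u" "y = f v" by auto
    then show "(x, y) \<in> parcs H" using arcs in_arcsD1 in_arcsD2 by blast
  next
    fix x y assume xy: "(x, y) \<in> parcs H"
    then obtain u v where "u \<in> pverts G" "v \<in> pverts G" "x = f u" "y = f v"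
      using H im by blast
    moreover from this have "(u, v) \<in> parcs G" using arcs xy by blast
    ultimately show "(x, y) \<in> map_prod f f ` parcs G" by force
  qed
  then have "with_proj H = app_iso hom (with_proj G)"
    using im by (simp add: app_iso_def hom_def with_proj_def)
  ultimately show ?thesis unfolding graph_isomorphic_def digraph_iso_def by blast
qed

lemma card_graph_isomorphic:
  assumes "graph_isomorphic G H"
  shows "card (pverts H) = card (pverts G)"
proof -
  obtain hom where "inj_on (iso_verts hom) (pverts G)" "with_proj H = app_iso hom (with_proj G)"
    using assms
    by (auto simp: graph_isomorphic_def digraph_iso_def pre_digraph.digraph_isomorphism_def)
  moreover from this have "pverts H = iso_verts hom ` pverts G"
    by (metis verts_app_iso with_proj_simps(1))
  ultimately show ?thesis by (simp add: card_image)
qed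

text \<open>The order alone tells a graph on two vertices apart from the exceptional ones.\<close>

lemma card_exceptional_graph:
  assumes "exceptional_graph G"
  shows "card (pverts G) = 9"
proof -
  have "card (UNIV :: G3_vertex set) = 9"
  proof -
    have U: "UNIV = set [G3_vertex.a1, G3_vertex.a2, G3_vertex.a3, G3_vertex.b1, G3_vertex.b2,
        G3_vertex.b3, G3_vertex.c1, G3_vertex.c2, G3_vertex.c3]"
      using G3_vertex.exhaust by auto
    show ?thesis unfolding U by simp
  qed
  then have "card (pverts G1) = 9" "card (pverts G2) = 9" "card (pverts G3) = 9"
    by (auto simp: G1_def G2_def G3_def card_cartesian_product)
  then show ?thesis using assms unfolding exceptional_graph_def
    by (elim disjE) (drule card_graph_isomorphic, simp add: graph_complement_def)+
qed

lemma frugal_chromatic_number_le: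
  assumes "frugal_coloring t G c"
  shows "frugal_chromatic_number t G \<le> card (c ` pverts G)"
  unfolding frugal_chromatic_number_def using assms by (intro Least_le) auto

text \<open>An injective coloring shows that the minimum defining the chromatic number is over a nonempty set.\<close>

lemma frugal_chromatic_number_attained:
  assumes fin: "finite (pverts G)" and G: "parcs G \<subseteq> pverts G \<times> pverts G"
    and loopfree: "\<And>v. (v, v) \<notin> parcs G" and "t \<ge> 1"
  obtains c where "frugal_coloring t G c" "card (c ` pverts G) = frugal_chromatic_number t G"
proof -
  obtain c :: "'a \<Rightarrow> nat" where inj: "inj_on c (pverts G)"
    using finite_imp_inj_to_nat_seg[OF fin] by blast
  have "frugal_coloring t G c"
    unfolding frugal_coloring_def
  proof (intro conjI ballI allI)
    show "proper_coloring G c"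
      unfolding proper_coloring_def using inj G loopfree by (auto dest: inj_onD)
  next
    fix v i
    have "{u \<in> open_neighborhood G v. c u = i} \<subseteq> {u \<in> pverts G. c u = i}"
      using G by (auto simp: open_neighborhood_def)
    moreover have "card {u \<in> pverts G. c u = i} \<le> 1"
      using inj fin by (auto simp: card_le_Suc0_iff_eq dest: inj_onD)
    moreover have "finite {u \<in> pverts G. c u = i}" using fin by simp
    ultimately show "card {u \<in> open_neighborhood G v. c u = i} \<le> t"
      using \<open>t \<ge> 1\<close> card_mono by (meson le_trans)
  qed
  then have "\<exists>k c. frugal_coloring t G c \<and> card (c ` pverts G) = k" by blast
  then have "\<exists>c. frugal_coloring t G c \<and> card (c ` pverts G) = frugal_chromatic_number t G"
    unfolding frugal_chromatic_number_def by (rule LeastI_ex)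
  then show ?thesis using that by blast
qed

lemma arcs_G2:
  "(x, y) \<in> parcs G2 \<longleftrightarrow>
    x \<in> pverts G2 \<and> y \<in> pverts G2 \<and> x \<noteq> y \<and> (fst x = fst y \<longleftrightarrow> snd x \<noteq> snd y)"
  unfolding G2_def pair_pre_digraph.simps mem_Collect_eq case_prod_conv by (rule refl)

section \<open>The bound and its sharpness\<close>

lemma frugal_sum_lower_bound:
  assumes "pair_graph G" and n: "card (pverts G) \<ge> 2" and not_G2: "\<not> graph_isomorphic G G2"
  shows "2 * (frugal_chromatic_number 2 G + frugal_chromatic_number 2 (graph_complement G))
    \<ge> card (pverts G) + 4"
proof -
  interpret pair_graph G by fact
  have sym: "(u, v) \<in> parcs G \<longleftrightarrow> (v, u) \<in> parcs G" for u v
    using pair_sym_arcs by (auto simp: symmetric_def dest: symD)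
  have loopfree: "(v, v) \<notin> parcs G" for v using pair_no_loops by fastforce
  have G: "parcs G \<subseteq> pverts G \<times> pverts G" using in_arcsD1 in_arcsD2 by auto
  obtain c where c: "frugal_coloring 2 G c" "card (c ` pverts G) = frugal_chromatic_number 2 G"
    using frugal_chromatic_number_attained[of G 2] pair_finite_verts G loopfree by auto
  have V: "pverts (graph_complement G) = pverts G" by (simp add: graph_complement_def)
  obtain d where d: "frugal_coloring 2 (graph_complement G) d"
    "card (d ` pverts G) = frugal_chromatic_number 2 (graph_complement G)"
    using frugal_chromatic_number_attained[of "graph_complement G" 2] pair_finite_verts V
    by (auto simp: graph_complement_def)
  interpret C: complementary_frugal_colorings "pverts G" "\<lambda>u v. (u, v) \<in> parcs G" c d
  proof
    fix v i assume v: "v \<in> pverts G"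
    have "{u \<in> pverts G. (v, u) \<in> parcs G \<and> c u = i} = {u \<in> open_neighborhood G v. c u = i}"
      using G by (auto simp: open_neighborhood_def)
    then show "card {u \<in> pverts G. (v, u) \<in> parcs G \<and> c u = i} \<le> 2"
      using c(1) v by (simp add: frugal_coloring_def)
    have "{u \<in> pverts G. (v \<noteq> u \<and> (v, u) \<notin> parcs G) \<and> d u = i}
        = {u \<in> open_neighborhood (graph_complement G) v. d u = i}"
      using v by (auto simp: open_neighborhood_def graph_complement_def)
    then show "card {u \<in> pverts G. (v \<noteq> u \<and> (v, u) \<notin> parcs G) \<and> d u = i} \<le> 2"
      using d(1) v by (simp add: frugal_coloring_def V)
  next
    fix u v
    show "(u, v) \<in> parcs G \<longleftrightarrow> (v, u) \<in> parcs G" by (rule sym)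
    show "c u \<noteq> c v" if "(u, v) \<in> parcs G"
      using c(1) that by (auto simp: frugal_coloring_def proper_coloring_def)
    show "d u \<noteq> d v" if "u \<in> pverts G" "v \<in> pverts G" "u \<noteq> v" "(u, v) \<notin> parcs G"
      using d(1) that by (auto simp: frugal_coloring_def proper_coloring_def graph_complement_def)
  qed (rule pair_finite_verts, rule loopfree)
  have "\<not> (card (pverts G) = 9 \<and> card (c ` pverts G) = 3 \<and> card (d ` pverts G) = 3)"
  proof
    assume "card (pverts G) = 9 \<and> card (c ` pverts G) = 3 \<and> card (d ` pverts G) = 3"
    then obtain f :: "'a \<Rightarrow> nat \<times> nat" where f: "bij_betw f (pverts G) ({1, 2, 3} \<times> {1, 2, 3})"
      and adj: "\<And>u v. \<lbrakk>u \<in> pverts G; v \<in> pverts G\<rbrakk>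
        \<Longrightarrow> (u, v) \<in> parcs G \<longleftrightarrow> u \<noteq> v \<and> (fst (f u) = fst (f v) \<longleftrightarrow> snd (f u) \<noteq> snd (f v))"
      using C.rook_coordinates by blast
    have "graph_isomorphic G G2"
    proof (rule graph_isomorphicI)
      show f': "bij_betw f (pverts G) (pverts G2)" using f unfolding G2_def pair_pre_digraph.simps .
      show "parcs G2 \<subseteq> pverts G2 \<times> pverts G2" using arcs_G2 by auto
      fix u v assume uv: "u \<in> pverts G" "v \<in> pverts G"
      have "f u \<in> pverts G2" "f v \<in> pverts G2" using bij_betw_apply[OF f'] uv by auto
      moreover have "f u = f v \<longleftrightarrow> u = v"
        using inj_on_eq_iff[OF bij_betw_imp_inj_on[OF f]] uv by blast
      ultimately show "(u, v) \<in> parcs G \<longleftrightarrow> (f u, f v) \<in> parcs G2"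
        using adj[OF uv] arcs_G2 by metis
    qed unfold_locales
    with not_G2 show False by contradiction
  qed
  then show ?thesis using C.bound_or_grid[OF n] c(2) d(2) by auto
qed

text \<open>Only an upper bound is shown; the lower bound is the case \<open>n = 2\<close> of \<open>frugal_sum_lower_bound\<close>.\<close>

lemma frugal_sum_single_edge:
  defines "K2 \<equiv> \<lparr>pverts = {0, 1 :: nat}, parcs = {(0, 1), (1, 0)}\<rparr>"
  shows "pair_graph K2" "card (pverts K2) = 2"
    "frugal_chromatic_number 2 K2 + frugal_chromatic_number 2 (graph_complement K2) \<le> 3"
proof -
  show "pair_graph K2"
    by unfold_locales (auto simp: K2_def symmetric_def intro: symI)
  show "card (pverts K2) = 2" by (simp add: K2_def)
  have "card {u \<in> open_neighborhood K2 v. u = i} \<le> 2" for v i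
  proof -
    have "card {u \<in> open_neighborhood K2 v. u = i} \<le> card {i}" by (rule card_mono) auto
    then show ?thesis by simp
  qed
  then have "frugal_coloring 2 K2 (\<lambda>v. v)"
    by (auto simp: frugal_coloring_def proper_coloring_def K2_def)
  then have "frugal_chromatic_number 2 K2 \<le> 2"
    using frugal_chromatic_number_le by (fastforce simp: K2_def)
  moreover have "parcs (graph_complement K2) = {}" by (auto simp: graph_complement_def K2_def)
  then have "frugal_coloring 2 (graph_complement K2) (\<lambda>v. 0)"
    by (auto simp: frugal_coloring_def proper_coloring_def open_neighborhood_def)
  then have "frugal_chromatic_number 2 (graph_complement K2) \<le> 1"
    using frugal_chromatic_number_le by (fastforce simp: K2_def graph_complement_def)
  ultimately show "frugal_chromatic_number 2 K2 + frugal_chromatic_number 2 (graph_complement K2) \<le> 3"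
    by linarith
qed

theorem theorem5p1:
  shows "(\<forall>G :: 'a pair_pre_digraph.
            pair_graph G \<and> card (pverts G) \<ge> 2 \<and> \<not> exceptional_graph G \<longrightarrow>
            real (frugal_chromatic_number 2 G) + real (frugal_chromatic_number 2 (graph_complement G))
              \<ge> real (card (pverts G)) / 2 + 2) \<and>
         (\<exists>G :: nat pair_pre_digraph.
            pair_graph G \<and> card (pverts G) \<ge> 2 \<and> \<not> exceptional_graph G \<and>
            real (frugal_chromatic_number 2 G) + real (frugal_chromatic_number 2 (graph_complement G))
              = real (card (pverts G)) / 2 + 2)"
proof (intro conjI allI impI)
  fix G :: "'a pair_pre_digraph"
  assume G: "pair_graph G \<and> card (pverts G) \<ge> 2 \<and> \<not> exceptional_graph G"
  then have "\<not> graph_isomorphic G G2" by (simp add: exceptional_graph_def)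
  with G have "real (card (pverts G) + 4)
      \<le> real (2 * (frugal_chromatic_number 2 G + frugal_chromatic_number 2 (graph_complement G)))"
    using frugal_sum_lower_bound of_nat_mono by blast
  then show "real (frugal_chromatic_number 2 G) + real (frugal_chromatic_number 2 (graph_complement G))
      \<ge> real (card (pverts G)) / 2 + 2"
    by simp
next
  let ?K2 = "\<lparr>pverts = {0, 1 :: nat}, parcs = {(0, 1), (1, 0)}\<rparr>"
  have K2: "\<not> exceptional_graph ?K2"
    using card_exceptional_graph frugal_sum_single_edge(2) by fastforce
  then have "\<not> graph_isomorphic ?K2 G2" by (simp add: exceptional_graph_def)
  then have "card (pverts ?K2) + 4
      \<le> 2 * (frugal_chromatic_number 2 ?K2 + frugal_chromatic_number 2 (graph_complement ?K2))"
    using frugal_sum_lower_bound frugal_sum_single_edge(1,2) by (metis order_refl)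
  then have "real (frugal_chromatic_number 2 ?K2) + real (frugal_chromatic_number 2 (graph_complement ?K2))
      = real (card (pverts ?K2)) / 2 + 2"
    using frugal_sum_single_edge(2,3) by simp
  then show "\<exists>G :: nat pair_pre_digraph.
      pair_graph G \<and> card (pverts G) \<ge> 2 \<and> \<not> exceptional_graph G \<and>
      real (frugal_chromatic_number 2 G) + real (frugal_chromatic_number 2 (graph_complement G))
        = real (card (pverts G)) / 2 + 2"
    using K2 frugal_sum_single_edge(1,2) by (metis order_refl)
qed

end
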